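(* Let $C\ge1$ and $\sigma\in(0,1)$, and let $\gamma_i:=C\sum_{n=0}^{i-1}\sigma^n$ for $i\in\mathbb{N}$. Suppose that $$V_i(x)\le\gamma_iV_1(x)\qquad\text{for all }x\in\mathbb{X}\text{ and all }i\in\mathbb{N}.$$ For $N\ge2$ and $m\in\{1,\ldots,N-1\}$ let $$\alpha_{N,m}:=1-\frac{\prod_{i=m+1}^N(\gamma_i-1)\ \prod_{i=N-m+1}^N(\gamma_i-1)}{\Big[\prod_{i=m+1}^N\gamma_i-\prod_{i=m+1}^N(\gamma_i-1)\Big]\Big[\prod_{i=N-m+1}^N\gamma_i-\prod_{i=N-m+1}^N(\gamma_i-1)\Big]}.$$ Then for every $N\ge2$: (i) (symmetry) $\alpha_{N,m}=\alpha_{N,N-m}$ for all $m\in\{1,\ldots,N-1\}$; (ii) (monotonicity) $\alpha_{N,m+1}\ge\alpha_{N,m}$ for all $m\in\{1,2,\ldots,\lfloor N/2\rfloor-1\}$. As a consequence, $\alpha_{N,m}\ge\alpha_{N,1}$ for all $m\in\{1,\ldots,N-1\}$; in particular, if $\alpha_{N,1}>0$, then $\alpha_{N,m}>0$ for every $m\in\{2,\ldots,N-1\}$.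
   Context: Setting. $(X,d_X)$ and $(U,d_U)$ are metric spaces, $f:X\times U\to X$, and the control system is $x(n+1)=f(x(n),u(n))$. $\mathbb{X}\subseteq X$ and $\mathbb{U}\subseteq U$ are constraint sets. For $x\in\mathbb{X}$ and a control sequence $u$, $x_u(\cdot;x)$ denotes the trajectory with $x_u(0;x)=x$, $x_u(n+1;x)=f(x_u(n;x),u(n))$. $\mathcal{U}^N(x)$ is the set of admissible control sequences $(u(0),\ldots,u(N-1))$, i.e. those with $u(n)\in\mathbb{U}$ and $f(x_u(n;x),u(n))\in\mathbb{X}$ for $n=0,\ldots,N-1$. $x^\star\in\mathbb{X}$ is a controlled equilibrium: $f(x^\star,u^\star)=x^\star$ for some control value $u^\star$. The stage cost $\ell:X\times U\to[0,\infty)$ is continuous with $\ell(x^\star,u^\star)=0$ and $\ell(x,u)>0$ for all $u\in U$ and all $x\ne x^\star$. Value functions. $J_N(x,u)=\sum_{n=0}^{N-1}\ell(x_u(n;x),u(n))$, $V_N(x)=\inf_{u\in\mathcal{U}^N(x)}J_N(x,u)$. Standing assumption: for each $x\in\mathbb{X}$ and each $N\in\mathbb{N}$ the set $\mathcal{U}^N(x)$ is nonempty and a minimizer of $J_N(x,\cdot)$ over $\mathcal{U}^N(x)$ exists. *)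

theory Defs
  imports Complex_Main
begin

primrec trajectory :: "('x \<Rightarrow> 'u \<Rightarrow> 'x) \<Rightarrow> (nat \<Rightarrow> 'u) \<Rightarrow> 'x \<Rightarrow> nat \<Rightarrow> 'x" where
  "trajectory f u x 0 = x"
| "trajectory f u x (Suc n) = f (trajectory f u x n) (u n)"

(* A control sequence (u(0), ..., u(N-1)) is a list of length N; the entries that nth leaves
   unspecified beyond the length are never evaluated below. *)

definition admissible ::
  "('x \<Rightarrow> 'u \<Rightarrow> 'x) \<Rightarrow> 'x set \<Rightarrow> 'u set \<Rightarrow> nat \<Rightarrow> 'x \<Rightarrow> 'u list set" where
  "admissible f XX UU N x =
     {u. length u = N \<and>
         (\<forall>n<N. u ! n \<in> UU \<and> f (trajectory f (nth u) x n) (u ! n) \<in> XX)}"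

definition cost ::
  "('x \<Rightarrow> 'u \<Rightarrow> 'x) \<Rightarrow> ('x \<Rightarrow> 'u \<Rightarrow> real) \<Rightarrow> nat \<Rightarrow> 'x \<Rightarrow> 'u list \<Rightarrow> real" where
  "cost f l N x u = (\<Sum>n<N. l (trajectory f (nth u) x n) (u ! n))"

(* Inf on the reals is the genuine infimum only for nonempty sets bounded below; this holds
   whenever l is nonnegative and admissible f XX UU N x is nonempty. *)

definition optimal_value ::
  "('x \<Rightarrow> 'u \<Rightarrow> 'x) \<Rightarrow> 'x set \<Rightarrow> 'u set \<Rightarrow> ('x \<Rightarrow> 'u \<Rightarrow> real) \<Rightarrow> nat \<Rightarrow> 'x \<Rightarrow> real" where
  "optimal_value f XX UU l N x = (INF u\<in>admissible f XX UU N x. cost f l N x u)"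

definition growth_bound :: "real \<Rightarrow> real \<Rightarrow> nat \<Rightarrow> real" where
  "growth_bound C \<sigma> i = C * (\<Sum>n<i. \<sigma> ^ n)"

definition suboptimality_index :: "(nat \<Rightarrow> real) \<Rightarrow> nat \<Rightarrow> nat \<Rightarrow> real" where
  "suboptimality_index \<gamma> N m =
     1 - ((\<Prod>i=m+1..N. (\<gamma> i - 1)) * (\<Prod>i=N-m+1..N. (\<gamma> i - 1))) /
         (((\<Prod>i=m+1..N. \<gamma> i) - (\<Prod>i=m+1..N. (\<gamma> i - 1))) *
          ((\<Prod>i=N-m+1..N. \<gamma> i) - (\<Prod>i=N-m+1..N. (\<gamma> i - 1))))"

end

theory Submission
  imports Defs
begin

text \<open>
  Put $z_k = \prod_{i=k+1}^N (1 - 1/\gamma_i)$. Then $1 - \alpha_{N,m}$ is the product of the odds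
  $z_k/(1 - z_k)$ at $k = m$ and $k = N - m$, which gives the symmetry. With $a = m + 1$ and
  $b = N - m$ the monotonicity becomes $h(b) \le h(a)$ for $h(k) = (\gamma_k - 1)(1 - z_k)$, and
  $h(k)$ telescopes to $\sum_{i=k+1}^N \prod_{j=k}^{i-1} r_j$ with $r_j = (\gamma_j - 1)/\gamma_{j+1}$.

  For $C = 1$ a closed form shows that $h$ is symmetric under $k \mapsto N + 1 - k$, so
  $h(a) = h(b)$. Passing to $C > 1$ multiplies $r_j$ by a factor that is at least $1$ and decreasing
  in $j$. The products starting at $a$ are termwise smaller than those starting at $b$ for $C = 1$,
  so the equal total is spread over longer products there, which are amplified more.
\<close>

section \<open>Weighted sums and telescoping tail products\<close>

text \<open>The equal totals force the excess of \<open>q\<close> over \<open>p\<close> below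
  \<open>A\<close> to be exactly the mass that \<open>p\<close> carries on \<open>{A..<B}\<close>.
  Moving that mass to later indices cannot lower a sum with increasing weights \<open>u\<close>,
  whatever their sign.\<close>

lemma sum_mult_le_sum_mult_of_termwise_le:
  fixes p q u v :: "nat \<Rightarrow> 'a::linordered_idom"
  assumes "A \<le> B" and total: "(\<Sum>n<B. p n) = (\<Sum>n<A. q n)"
    and p: "\<And>n. 0 \<le> p n" and pq: "\<And>n. p n \<le> q n"
    and u: "mono u" and vu: "\<And>n. v n \<le> u n"
  shows "(\<Sum>n<A. q n * v n) \<le> (\<Sum>n<B. p n * u n)"
proof -
  have split: "(\<Sum>n<B. g n) = (\<Sum>n<A. g n) + (\<Sum>n\<in>{A..<B}. g n)" for g :: "nat \<Rightarrow> 'a"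
    using \<open>A \<le> B\<close> by (simp add: atLeast0LessThan[symmetric] sum.atLeastLessThan_concat)
  have "(\<Sum>n<A. q n * v n) \<le> (\<Sum>n<A. q n * u n)"
    using p pq vu by (intro sum_mono mult_left_mono) (auto intro: order_trans)
  also have "\<dots> = (\<Sum>n<A. p n * u n) + (\<Sum>n<A. (q n - p n) * u n)"
    by (simp add: sum.distrib[symmetric] algebra_simps)
  \<comment> \<open>The constant \<open>u A\<close> separates the two ranges: it bounds
    \<open>u\<close> from above before \<open>A\<close> and from below from \<open>A\<close>
    on.\<close>
  also have "(\<Sum>n<A. (q n - p n) * u n) \<le> (\<Sum>n<A. (q n - p n) * u A)"
    using pq u by (intro sum_mono mult_left_mono) (auto intro: monoD[OF u])
  also have "\<dots> = ((\<Sum>n<A. q n) - (\<Sum>n<A. p n)) * u A"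
    by (simp add: sum_distrib_right[symmetric] sum_subtractf)
  also have "\<dots> = (\<Sum>n\<in>{A..<B}. p n * u A)"
    using total split[of p] by (simp add: sum_distrib_right[symmetric])
  also have "\<dots> \<le> (\<Sum>n\<in>{A..<B}. p n * u n)"
    using p u by (intro sum_mono mult_left_mono) (auto intro: monoD[OF u])
  finally show ?thesis
    using split[of "\<lambda>n. p n * u n"] by simp
qed

text \<open>Each numerator is paired with the denominator one index later. The left side is the
  increment in the telescoping sum of the next lemma.\<close>

lemma prod_ratio_shift:
  fixes g :: "nat \<Rightarrow> 'a::field"
  shows "(g k - 1) * (\<Prod>i=k+1..k+d. (g i - 1) / g i) / g (k + d + 1)
    = (\<Prod>j\<le>d. (g (k + j) - 1) / g (k + j + 1))"
proof (induction d)
  case (Suc d)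
  have "(g k - 1) * (\<Prod>i=k+1..k+Suc d. (g i - 1) / g i) / g (k + Suc d + 1)
    = ((g k - 1) * (\<Prod>i=k+1..k+d. (g i - 1) / g i) / g (k + d + 1))
      * ((g (k + Suc d) - 1) / g (k + Suc d + 1))"
    by simp
  then show ?case
    unfolding Suc.IH by simp
qed simp

text \<open>Appending the factor \<open>1 - 1 / g (k + d + 1)\<close> lowers the product
  \<open>?z\<close> by \<open>?z / g (k + d + 1)\<close>; after scaling by \<open>g k - 1\<close>
  this loss is a shifted product.\<close>

lemma one_minus_prod_ratio_telescope:
  fixes g :: "nat \<Rightarrow> 'a::field"
  assumes "\<And>i. i > k \<Longrightarrow> g i \<noteq> 0"
  shows "(g k - 1) * (1 - (\<Prod>i=k+1..k+d. (g i - 1) / g i))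
    = (\<Sum>n<d. \<Prod>j\<le>n. (g (k + j) - 1) / g (k + j + 1))"
proof (induction d)
  case (Suc d)
  let ?z = "\<Prod>i=k+1..k+d. (g i - 1) / g i"
  have ne: "g (k + d + 1) \<noteq> 0"
    using assms by simp
  have "(g k - 1) * (1 - (\<Prod>i=k+1..k+Suc d. (g i - 1) / g i))
    = (g k - 1) * (1 - ?z * ((g (k + d + 1) - 1) / g (k + d + 1)))"
    by simp
  also have "\<dots> = (g k - 1) * (1 - ?z) + (g k - 1) * ?z / g (k + d + 1)"
    using ne by (simp add: field_simps)
  finally show ?case
    by (simp only: Suc.IH prod_ratio_shift sum.lessThan_Suc)
qed simp

section \<open>Geometric growth bounds\<close>

lemma growth_bound_eq_mult: "growth_bound C \<sigma> i = C * growth_bound 1 \<sigma> i"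
  by (simp add: growth_bound_def)

lemma growth_bound_Suc: "growth_bound 1 \<sigma> (Suc i) = 1 + \<sigma> * growth_bound 1 \<sigma> i"
  unfolding growth_bound_def by (simp add: sum.lessThan_Suc_shift sum_distrib_left del: sum.lessThan_Suc)

lemma growth_bound_add:
  "growth_bound 1 \<sigma> (d + k) = growth_bound 1 \<sigma> d + \<sigma> ^ d * growth_bound 1 \<sigma> k"
  by (induction k) (simp_all add: growth_bound_def algebra_simps power_add)

lemma growth_bound_mono:
  assumes "0 \<le> C" "0 \<le> \<sigma>" "i \<le> j"
  shows "growth_bound C \<sigma> i \<le> growth_bound C \<sigma> j"
  unfolding growth_bound_def using assms by (intro mult_left_mono sum_mono2) auto

lemma growth_bound_pos:
  assumes "0 < C" "0 \<le> \<sigma>" "1 \<le> i"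
  shows "0 < growth_bound C \<sigma> i"
  using assms growth_bound_mono[of C \<sigma> 1 i] by (simp add: growth_bound_def)

lemma growth_bound_gt_one:
  assumes "1 \<le> C" "0 < \<sigma>" "2 \<le> i"
  shows "1 < growth_bound C \<sigma> i"
proof -
  have "1 < 1 + \<sigma>" using assms by simp
  also have "\<dots> = growth_bound 1 \<sigma> 2" by (simp add: growth_bound_def numeral_2_eq_2)
  also have "\<dots> \<le> growth_bound 1 \<sigma> i" using assms by (intro growth_bound_mono) auto
  also have "\<dots> \<le> C * growth_bound 1 \<sigma> i"
    using assms growth_bound_pos[of 1 \<sigma> i] by simp
  finally show ?thesis using growth_bound_eq_mult[of C] by simp
qed

text \<open>For \<open>d = N - k\<close> the numerator is \<sigma> times the growth bounds at
  \<open>k - 1\<close> and \<open>N - k\<close>, and the denominator depends on \<open>N\<close>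
  alone; hence the symmetry under \<open>k\<close> to \<open>N + 1 - k\<close>.\<close>

lemma sum_prod_ratio_closed_form:
  fixes \<sigma> :: real
  assumes "0 < \<sigma>" "1 \<le> k"
  shows "(\<Sum>n<d. \<Prod>j\<le>n. (growth_bound 1 \<sigma> (k + j) - 1) / growth_bound 1 \<sigma> (k + j + 1))
    = \<sigma> * growth_bound 1 \<sigma> (k - 1) * growth_bound 1 \<sigma> d / growth_bound 1 \<sigma> (k + d)"
proof -
  define s where "s = growth_bound 1 \<sigma>"
  have pos: "0 < s i" if "1 \<le> i" for i
    using growth_bound_pos[of 1 \<sigma> i] assms that by (simp add: s_def)
  have s_Suc: "s (Suc i) = 1 + \<sigma> * s i" for i
    by (simp add: s_def growth_bound_Suc)
  \<comment> \<open>Since \<open>s i - 1 = \<sigma> * s (i - 1)\<close>, every numerator cancels the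
    preceding denominator up to a factor \<sigma>.\<close>
  have prod: "(\<Prod>i=k+1..k+d. (s i - 1) / s i) = \<sigma> ^ d * s k / s (k + d)"
  proof (induction d)
    case (Suc d)
    then show ?case
      using pos[of "k + d"] assms by (simp add: s_Suc)
  qed (use pos[of k] assms in simp)
  have k: "s k - 1 = \<sigma> * s (k - 1)"
    using s_Suc[of "k - 1"] assms by simp
  have kd: "s (k + d) = s d + \<sigma> ^ d * s k"
    using growth_bound_add[of \<sigma> d k] by (simp add: s_def add.commute)
  have pkd: "0 < s (k + d)" using pos assms by simp
  have ne: "s i \<noteq> 0" if "k < i" for i
    using pos[of i] that by simp
  have "(\<Sum>n<d. \<Prod>j\<le>n. (s (k + j) - 1) / s (k + j + 1))
    = (s k - 1) * (1 - \<sigma> ^ d * s k / s (k + d))"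
    using one_minus_prod_ratio_telescope[of k s d, OF ne] prod by simp
  also have "1 - \<sigma> ^ d * s k / s (k + d) = s d / s (k + d)"
    using kd pkd by (simp add: field_simps)
  finally show ?thesis
    by (simp add: s_def k[unfolded s_def])
qed

section \<open>Comparison of the tail gaps at mirrored indices\<close>

lemma weighted_tail_gap_le:
  fixes C \<sigma> :: real
  defines "\<gamma> \<equiv> growth_bound C \<sigma>"
  assumes C: "1 \<le> C" and \<sigma>: "0 < \<sigma>" and a: "2 \<le> a" and ab: "a \<le> b" and N: "a + b = N + 1"
  shows "(\<gamma> b - 1) * (1 - (\<Prod>i=b+1..N. (\<gamma> i - 1) / \<gamma> i))
    \<le> (\<gamma> a - 1) * (1 - (\<Prod>i=a+1..N. (\<gamma> i - 1) / \<gamma> i))"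
proof -
  define s where "s = growth_bound 1 \<sigma>"
  define r where "r j = (s j - 1) / s (j + 1)" for j
  \<comment> \<open>The amplification caused by \<open>C\<close>: \<open>w j\<close> is
    \<open>(s j - 1 / C) / (s j - 1)\<close>, with numerator split as
    \<open>(s j - 1) + (1 - 1 / C)\<close>. Indices start at 2 because
    \<open>s 1 = 1\<close>.\<close>
  define w where "w j = 1 + (1 - 1 / C) / (s j - 1)" for j
  have \<gamma>: "\<gamma> i = C * s i" for i
    unfolding \<gamma>_def s_def by (rule growth_bound_eq_mult)
  have s1: "1 < s i" if "2 \<le> i" for i
    using growth_bound_gt_one[of 1 \<sigma> i] \<sigma> that by (simp add: s_def)
  have smono: "s i \<le> s j" if "i \<le> j" for i j
    using growth_bound_mono[of 1 \<sigma> i j] \<sigma> that by (simp add: s_def)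
  have s_Suc: "s (Suc j) = 1 + \<sigma> * s j" for j
    by (simp add: s_def growth_bound_Suc)
  have ratio: "(\<gamma> j - 1) / \<gamma> (j + 1) = r j * w j" if "2 \<le> j" for j
    using s1[OF that] s1[of "j + 1"] that C by (simp add: \<gamma> r_def w_def field_simps)
  have r_pos: "0 \<le> r j" if "2 \<le> j" for j
    using s1[OF that] s1[of "j + 1"] that by (simp add: r_def)
  \<comment> \<open>After cross-multiplication the terms \<open>\<sigma> * s i * s j\<close> cancel,
    leaving \<open>(1 + \<sigma>) * s i \<le> (1 + \<sigma>) * s j\<close>.\<close>
  have r_mono: "r i \<le> r j" if "2 \<le> i" "i \<le> j" for i j
  proof -
    have "0 < 1 + \<sigma> * s i" "0 < 1 + \<sigma> * s j"
      using s1[of i] s1[of j] that \<sigma> by (auto intro: add_pos_pos)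
    moreover have "(1 + \<sigma>) * s i \<le> (1 + \<sigma>) * s j"
      using smono[OF that(2)] \<sigma> by simp
    then have "(s i - 1) * (1 + \<sigma> * s j) \<le> (s j - 1) * (1 + \<sigma> * s i)"
      by (simp add: algebra_simps)
    ultimately show ?thesis
      by (simp add: r_def s_Suc pos_divide_le_eq pos_le_divide_eq)
  qed
  have w_ge: "1 \<le> w j" if "2 \<le> j" for j
    using s1[OF that] C by (simp add: w_def)
  have w_anti: "w j \<le> w i" if "2 \<le> i" "i \<le> j" for i j
    using s1[of i] smono[OF that(2)] that C by (auto simp: w_def intro!: divide_left_mono)
  have gap: "(\<gamma> k - 1) * (1 - (\<Prod>i=k+1..N. (\<gamma> i - 1) / \<gamma> i))
    = (\<Sum>n<N - k. (\<Prod>j\<le>n. r (k + j)) * (\<Prod>j\<le>n. w (k + j)))" if "2 \<le> k" "k \<le> N" for k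
  proof -
    have "\<gamma> i \<noteq> 0" if "i > k" for i
      using s1[of i] \<open>2 \<le> k\<close> that C by (simp add: \<gamma>)
    from one_minus_prod_ratio_telescope[of k \<gamma> "N - k", OF this]
    show ?thesis
      using that ratio by (simp add: prod.distrib[symmetric])
  qed
  have closed: "(\<Sum>n<N - k. \<Prod>j\<le>n. r (k + j)) = \<sigma> * s (k - 1) * s (N - k) / s N"
    if "2 \<le> k" "k \<le> N" for k
    using sum_prod_ratio_closed_form[of \<sigma> k "N - k"] \<sigma> that by (simp add: s_def r_def)
  have idx: "N - a = b - 1" "N - b = a - 1"
    using N by auto
  \<comment> \<open>By \<open>idx\<close> the two closed forms have the same factors
    \<open>s (a - 1)\<close> and \<open>s (b - 1)\<close>, in swapped order.\<close>
  have total: "(\<Sum>n<N - a. \<Prod>j\<le>n. r (a + j)) = (\<Sum>n<N - b. \<Prod>j\<le>n. r (b + j))"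
    using closed[of a] closed[of b] a ab N by (simp add: idx)
  have "(\<Sum>n<N - b. (\<Prod>j\<le>n. r (b + j)) * (\<Prod>j\<le>n. w (b + j)))
    \<le> (\<Sum>n<N - a. (\<Prod>j\<le>n. r (a + j)) * (\<Prod>j\<le>n. w (a + j)))"
  \<comment> \<open>The longer sum starts at \<open>a\<close>. Its \<open>r\<close>-products are the
    smaller ones as \<open>r\<close> increases, and its \<open>w\<close>-products are the larger
    ones as \<open>w\<close> decreases; they grow with \<open>n\<close> as \<open>w\<close> is at
    least 1.\<close>
  proof (rule sum_mult_le_sum_mult_of_termwise_le[OF _ total])
    show "mono (\<lambda>n. \<Prod>j\<le>n. w (a + j))"
    proof (rule mono_iff_le_Suc[THEN iffD2], intro allI)
      fix n
      have "0 \<le> (\<Prod>j\<le>n. w (a + j))"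
        using a by (intro prod_nonneg) (auto intro: order_trans[OF zero_le_one w_ge])
      then show "(\<Prod>j\<le>n. w (a + j)) \<le> (\<Prod>j\<le>Suc n. w (a + j))"
        using w_ge[of "a + Suc n"] a mult_left_mono[of 1 "w (a + Suc n)"] by simp
    qed
    show "(\<Prod>j\<le>n. w (b + j)) \<le> (\<Prod>j\<le>n. w (a + j))" for n
      using a ab by (intro prod_mono conjI w_anti order_trans[OF zero_le_one w_ge]) auto
    show "(\<Prod>j\<le>n. r (a + j)) \<le> (\<Prod>j\<le>n. r (b + j))" for n
      using a ab by (intro prod_mono conjI r_mono r_pos) auto
    show "0 \<le> (\<Prod>j\<le>n. r (a + j))" for n
      using a by (intro prod_nonneg) (auto intro: r_pos)
  qed (use ab in simp)
  then show ?thesis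
    using gap[of a] gap[of b] a ab N by simp
qed

section \<open>The suboptimality index as a product of odds\<close>

lemma prod_ratio_less_one:
  fixes g :: "nat \<Rightarrow> real"
  assumes "k < N" and "\<And>i. k < i \<Longrightarrow> 1 < g i"
  shows "(\<Prod>i=k+1..N. (g i - 1) / g i) < 1"
proof -
  have g: "1 < g i" if "i \<in> {k+1..N}" for i
    using assms(2)[of i] that by simp
  have "(\<Prod>i=k+1..N. (g i - 1) / g i) < (\<Prod>i=k+1..N. 1)"
  proof (rule prod_mono_strict[of "k + 1"])
    show "0 \<le> (g i - 1) / g i \<and> (g i - 1) / g i \<le> 1" if "i \<in> {k+1..N}" for i
      using g[OF that] by simp
  qed (use g[of "k + 1"] assms(1) in auto)
  then show ?thesis by simp
qed

lemma suboptimality_index_symmetric: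
  "m \<le> N \<Longrightarrow> suboptimality_index \<gamma> N (N - m) = suboptimality_index \<gamma> N m"
  by (simp add: suboptimality_index_def mult.commute)

text \<open>Divide numerator and denominator of each of the two factors by its product of the
  \<gamma> values. Both \<open>m\<close> and \<open>N - m\<close> are at least 1, so only indices
  from 2 on occur.\<close>

lemma suboptimality_index_eq_odds:
  fixes \<gamma> :: "nat \<Rightarrow> real"
  defines "z \<equiv> \<lambda>k N. \<Prod>i=k+1..N. (\<gamma> i - 1) / \<gamma> i"
  assumes "\<And>i. 2 \<le> i \<Longrightarrow> 0 < \<gamma> i" and "1 \<le> m" "m < N"
  shows "suboptimality_index \<gamma> N m
    = 1 - (z m N / (1 - z m N)) * (z (N - m) N / (1 - z (N - m) N))"
proof -
  have odds: "z k N / (1 - z k N) = (\<Prod>i=k+1..N. \<gamma> i - 1) /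
      ((\<Prod>i=k+1..N. \<gamma> i) - (\<Prod>i=k+1..N. \<gamma> i - 1))" if "1 \<le> k" for k
  proof -
    have "0 < (\<Prod>i=k+1..N. \<gamma> i)"
      using assms(2) that by (intro prod_pos) auto
    then have "1 - z k N = ((\<Prod>i=k+1..N. \<gamma> i) - (\<Prod>i=k+1..N. \<gamma> i - 1)) / (\<Prod>i=k+1..N. \<gamma> i)"
      unfolding z_def prod_dividef by (simp add: diff_divide_distrib del: prod_zero_iff)
    with \<open>0 < (\<Prod>i=k+1..N. \<gamma> i)\<close> show ?thesis
      by (simp add: z_def prod_dividef del: prod_zero_iff)
  qed
  show ?thesis
    using assms(3,4) by (simp add: odds suboptimality_index_def)
qed

text \<open>Used with \<open>x\<close>, \<open>y\<close> the tail products at \<open>m + 1\<close>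
  and \<open>N - m\<close>, and \<open>c\<close>, \<open>d\<close> the \<gamma> values there. Then
  \<open>x'\<close> and \<open>y'\<close> are the tail products one index lower, so the two sides
  are 1 minus the index at \<open>m + 1\<close> and at \<open>m\<close>.\<close>

lemma odds_product_le:
  fixes x y c d :: real
  assumes "0 < x" "x < 1" "0 < y" "y < 1" "1 < c" "1 < d"
    and gap: "(d - 1) * (1 - y) \<le> (c - 1) * (1 - x)"
  defines "x' \<equiv> (c - 1) / c * x" and "y' \<equiv> (d - 1) / d * y"
  shows "(x / (1 - x)) * (y' / (1 - y')) \<le> (x' / (1 - x')) * (y / (1 - y))"
proof -
  have odds: "((c - 1) / c * x) / (1 - (c - 1) / c * x) = (c - 1) * x / (c - (c - 1) * x)"
    if "1 < c" for c x :: real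
  proof -
    have "1 - (c - 1) / c * x = (c - (c - 1) * x) / c"
      using that by (simp add: field_simps)
    then show ?thesis
      using that by simp
  qed
  have pos: "0 < c - (c - 1) * x" if "1 < c" "x < 1" for c x :: real
  proof -
    have "(c - 1) * x < (c - 1) * 1" using that by (intro mult_strict_left_mono) auto
    then show ?thesis by simp
  qed
  \<comment> \<open>Writing \<open>c - (c - 1) * x\<close> as \<open>1 + (c - 1) * (1 - x)\<close>,
    and likewise for \<open>d\<close> and \<open>y\<close>, shows that both sides share the term
    \<open>(c - 1) * (d - 1) * (1 - x) * (1 - y)\<close>; what remains is
    \<open>gap\<close>.\<close>
  have "(d - 1) * ((1 - y) * (c - (c - 1) * x)) = (c - 1) * ((d - 1) * (1 - x) * (1 - y)) + (d - 1) * (1 - y)"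
    by (simp add: algebra_simps)
  also have "\<dots> \<le> (c - 1) * ((d - 1) * (1 - x) * (1 - y)) + (c - 1) * (1 - x)"
    using gap by simp
  also have "\<dots> = (c - 1) * ((1 - x) * (d - (d - 1) * y))"
    by (simp add: algebra_simps)
  finally have "(x * y) * ((d - 1) * ((1 - y) * (c - (c - 1) * x)))
      \<le> (x * y) * ((c - 1) * ((1 - x) * (d - (d - 1) * y)))"
    using assms by (intro mult_left_mono) auto
  moreover have "0 < (1 - x) * (d - (d - 1) * y)" "0 < (c - (c - 1) * x) * (1 - y)"
    using assms pos by auto
  ultimately have "x * ((d - 1) * y) / ((1 - x) * (d - (d - 1) * y))
      \<le> (c - 1) * x * y / ((c - (c - 1) * x) * (1 - y))"
    by (simp add: frac_le_eq divide_le_eq pos_le_divide_eq mult_ac)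
  then show ?thesis
    unfolding x'_def y'_def odds[OF \<open>1 < c\<close>] odds[OF \<open>1 < d\<close>] by simp
qed

section \<open>Monotonicity up to the midpoint and its consequences\<close>

lemma suboptimality_index_growth_bound_step:
  fixes C \<sigma> :: real
  assumes C: "1 \<le> C" and \<sigma>: "0 < \<sigma>" and m: "1 \<le> m" "2 * (m + 1) \<le> N"
  shows "suboptimality_index (growth_bound C \<sigma>) N m
    \<le> suboptimality_index (growth_bound C \<sigma>) N (m + 1)"
proof -
  define \<gamma> where "\<gamma> = growth_bound C \<sigma>"
  define z where "z k = (\<Prod>i=k+1..N. (\<gamma> i - 1) / \<gamma> i)" for k
  define b where "b = N - m"
  have g: "1 < \<gamma> i" if "2 \<le> i" for i
    using growth_bound_gt_one[of C \<sigma> i] C \<sigma> that by (simp add: \<gamma>_def)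
  have z_pos: "0 < z k" if "1 \<le> k" for k
    unfolding z_def
    using g that by (intro prod_pos) (auto intro!: divide_pos_pos intro: less_trans[OF zero_less_one])
  have z_less: "z k < 1" if "1 \<le> k" "k < N" for k
    unfolding z_def using g that by (intro prod_ratio_less_one) auto
  have step: "z k = (\<gamma> (k + 1) - 1) / \<gamma> (k + 1) * z (k + 1)" if "k < N" for k
    unfolding z_def using that by (subst prod.atLeast_Suc_atMost) auto
  \<comment> \<open>The bound \<open>2 * (m + 1) \<le> N\<close> is what places \<open>m + 1\<close>
    before \<open>b\<close>; the two indices are mirror images, with sum
    \<open>N + 1\<close>.\<close>
  have idx: "N - (m + 1) = b - 1" "b - 1 + 1 = b" "N - m = b" "m + 1 < b" "b < N" "m + 1 + b = N + 1"
    using m by (auto simp: b_def)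
  have "(\<gamma> b - 1) * (1 - z b) \<le> (\<gamma> (m + 1) - 1) * (1 - z (m + 1))"
    unfolding z_def \<gamma>_def using C \<sigma> m idx by (intro weighted_tail_gap_le) auto
  from odds_product_le[OF z_pos z_less z_pos z_less g g this]
  have "(z (m + 1) / (1 - z (m + 1))) * (z (b - 1) / (1 - z (b - 1)))
      \<le> (z m / (1 - z m)) * (z b / (1 - z b))"
    using m idx step[of m] step[of "b - 1"] by simp
  moreover have "suboptimality_index \<gamma> N k = 1 - (z k / (1 - z k)) * (z (N - k) / (1 - z (N - k)))"
    if "1 \<le> k" "k < N" for k
    unfolding z_def using g that by (intro suboptimality_index_eq_odds) (auto intro: less_trans[OF zero_less_one])
  ultimately show ?thesis
    using m idx by (simp add: \<gamma>_def)
qed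

text \<open>Climb from 1 by the step lemma while \<open>2 * k \<le> N\<close>, and reflect the upper
  half onto the lower by symmetry.\<close>

lemma suboptimality_index_growth_bound_ge_first:
  fixes C \<sigma> :: real
  assumes C: "1 \<le> C" and \<sigma>: "0 < \<sigma>" and m: "1 \<le> m" "m < N"
  shows "suboptimality_index (growth_bound C \<sigma>) N 1 \<le> suboptimality_index (growth_bound C \<sigma>) N m"
proof -
  have half: "suboptimality_index (growth_bound C \<sigma>) N 1
      \<le> suboptimality_index (growth_bound C \<sigma>) N k" if "1 \<le> k" "2 * k \<le> N" for k
    using that
  proof (induction k rule: dec_induct)
    case (step k)
    then show ?case
      using suboptimality_index_growth_bound_step[OF C \<sigma>, of k N] by simp
  qed simp
  show ?thesis
  proof (cases "2 * m \<le> N")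
    case True
    with half m show ?thesis by simp
  next
    case False
    then show ?thesis
      using half[of "N - m"] m suboptimality_index_symmetric[of m N] by simp
  qed
qed

theorem proposition7:
  fixes f :: "'x::metric_space \<Rightarrow> 'u::metric_space \<Rightarrow> 'x"
    and XX :: "'x set" and UU :: "'u set"
    and l :: "'x \<Rightarrow> 'u \<Rightarrow> real"
    and xs :: 'x and us :: 'u
    and C \<sigma> :: real
  defines "V \<equiv> optimal_value f XX UU l"
    and "\<gamma> \<equiv> growth_bound C \<sigma>"
    and "\<alpha> \<equiv> suboptimality_index (growth_bound C \<sigma>)"
  assumes "xs \<in> XX" and "f xs us = xs"
    and "continuous_on UNIV (\<lambda>(x, u). l x u)"
    and "\<And>x u. 0 \<le> l x u"
    and "l xs us = 0"
    and "\<And>x u. x \<noteq> xs \<Longrightarrow> 0 < l x u"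
    and "\<And>x N. x \<in> XX \<Longrightarrow> 1 \<le> N \<Longrightarrow> admissible f XX UU N x \<noteq> {}"
    and "\<And>x N. x \<in> XX \<Longrightarrow> 1 \<le> N \<Longrightarrow>
           \<exists>u\<in>admissible f XX UU N x. \<forall>v\<in>admissible f XX UU N x. cost f l N x u \<le> cost f l N x v"
    and "1 \<le> C" and "0 < \<sigma>" and "\<sigma> < 1"
    and "\<And>x i. x \<in> XX \<Longrightarrow> 1 \<le> i \<Longrightarrow> V i x \<le> \<gamma> i * V 1 x"
  shows "\<forall>N\<ge>2.
      (\<forall>m\<in>{1..N - 1}. \<alpha> N m = \<alpha> N (N - m)) \<and>
      (\<forall>m\<in>{1..N div 2 - 1}. \<alpha> N (m + 1) \<ge> \<alpha> N m) \<and>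
      (\<forall>m\<in>{1..N - 1}. \<alpha> N m \<ge> \<alpha> N 1) \<and>
      (\<alpha> N 1 > 0 \<longrightarrow> (\<forall>m\<in>{2..N - 1}. \<alpha> N m > 0))"
proof (intro allI impI conjI ballI)
  fix N :: nat
  assume "2 \<le> N"
  show "\<alpha> N m = \<alpha> N (N - m)" if "m \<in> {1..N - 1}" for m
    using that suboptimality_index_symmetric[of m N] by (auto simp: \<alpha>_def)
  \<comment> \<open>As \<open>m\<close> is at least 1, truncated subtraction is harmless in
    \<open>N div 2 - 1\<close>, and the range gives \<open>2 * (m + 1) \<le> N\<close>.\<close>
  show "\<alpha> N m \<le> \<alpha> N (m + 1)" if "m \<in> {1..N div 2 - 1}" for m
    unfolding \<alpha>_def using that \<open>1 \<le> C\<close> \<open>0 < \<sigma>\<close>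
    by (intro suboptimality_index_growth_bound_step) auto
  show first: "\<alpha> N 1 \<le> \<alpha> N m" if "m \<in> {1..N - 1}" for m
    unfolding \<alpha>_def using that \<open>2 \<le> N\<close> \<open>1 \<le> C\<close> \<open>0 < \<sigma>\<close>
    by (intro suboptimality_index_growth_bound_ge_first) auto
  show "0 < \<alpha> N m" if "0 < \<alpha> N 1" "m \<in> {2..N - 1}" for m
    using first[of m] that by simp
qed

end
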